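(* Let $X$ be a Banach space. (i) If $f:X\to\mathbb{R}$ is ideally quasiconvex, then $f$ is quasiconvex and densely continuous. (ii) If $f:X\to\mathbb{R}$ is strongly ideally quasiconvex and $m:=\mathcal{T}\operatorname{ess\,inf}_X f$, then $f$ is quasiconvex and densely continuous and $F_m$ is nowhere dense. More generally, this conclusion holds if $f$ is ideally quasiconvex and $F_m$ is ideally convex.
   Context: Banach spaces are real. A subset $C\subset X$ is ideally convex if $\sum_{n=1}^\infty\lambda_nx_n\in C$ for every bounded sequence $(x_n)\subset C$ and every sequence $(\lambda_n)\subset[0,1]$ with $\sum_{n=1}^\infty\lambda_n=1$. For $f:X\to\mathbb{R}$ and $\alpha\in\mathbb{R}\cup\{-\infty\}$, $F_\alpha:=\{x\in X:f(x)<\alpha\}$ and $F'_\alpha:=\{x\in X:f(x)\le\alpha\}$ (both empty for $\alpha=-\infty$). The function $f$ is ideally quasiconvex if all the sets $F'_\alpha$ ($\alpha\in\mathbb{R}$) are ideally convex, and strongly ideally quasiconvex if all the sets $F_\alpha$ ($\alpha\in\mathbb{R}$) are ideally convex. It is quasiconvex if $f(\lambda x+(1-\lambda)y)\le\max\{f(x),f(y)\}$ for all $x,y\in X$ and $\lambda\in[0,1]$, and densely continuous if it is continuous at the points of a dense subset of $X$. First category means a countable union of nowhere dense subsets of $X$; second category means not of first category. The topological essential infimum is $\mathcal{T}\operatorname{ess\,inf}_X f:=\sup\{\alpha\in\mathbb{R}:F_\alpha\text{ is of first category}\}=\inf\{\alpha\in\mathbb{R}:F_\alpha\text{ is of second category}\}\in[-\infty,\infty)$.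 *)

theory Defs
  imports "HOL-Analysis.Analysis"
begin

text \<open>In a Banach space the series below converges absolutely, so \<^const>\<open>suminf\<close> denotes its sum.\<close>

definition ideally_convex :: "'a::banach set \<Rightarrow> bool" where
  "ideally_convex C \<longleftrightarrow>
    (\<forall>(x :: nat \<Rightarrow> 'a) (l :: nat \<Rightarrow> real).
      (\<forall>n. x n \<in> C) \<and> bounded (range x) \<and> (\<forall>n. l n \<in> {0..1}) \<and> l sums 1
        \<longrightarrow> (\<Sum>n. l n *\<^sub>R x n) \<in> C)"

text \<open>The sets \<open>F\<^sub>\<alpha>\<close> and \<open>F'\<^sub>\<alpha>\<close>. The level is an extended real, so that \<open>\<alpha> = -\<infinity>\<close> is allowed;
  both sets are then empty.\<close>

definition strict_sublevel :: "('a \<Rightarrow> real) \<Rightarrow> ereal \<Rightarrow> 'a set" where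
  "strict_sublevel f \<alpha> = {x. ereal (f x) < \<alpha>}"

definition sublevel :: "('a \<Rightarrow> real) \<Rightarrow> ereal \<Rightarrow> 'a set" where
  "sublevel f \<alpha> = {x. ereal (f x) \<le> \<alpha>}"

definition ideally_quasiconvex :: "('a::banach \<Rightarrow> real) \<Rightarrow> bool" where
  "ideally_quasiconvex f \<longleftrightarrow> (\<forall>\<alpha>::real. ideally_convex (sublevel f (ereal \<alpha>)))"

definition strongly_ideally_quasiconvex :: "('a::banach \<Rightarrow> real) \<Rightarrow> bool" where
  "strongly_ideally_quasiconvex f \<longleftrightarrow> (\<forall>\<alpha>::real. ideally_convex (strict_sublevel f (ereal \<alpha>)))"

definition quasiconvex :: "('a::real_vector \<Rightarrow> real) \<Rightarrow> bool" where
  "quasiconvex f \<longleftrightarrow>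
    (\<forall>x y. \<forall>l\<in>{0..1}. f (l *\<^sub>R x + (1 - l) *\<^sub>R y) \<le> max (f x) (f y))"

definition densely_continuous :: "('a::t2_space \<Rightarrow> real) \<Rightarrow> bool" where
  "densely_continuous f \<longleftrightarrow> (\<exists>D. closure D = UNIV \<and> (\<forall>x\<in>D. isCont f x))"

definition nowhere_dense :: "'a::topological_space set \<Rightarrow> bool" where
  "nowhere_dense S \<longleftrightarrow> interior (closure S) = {}"

definition first_category :: "'a::topological_space set \<Rightarrow> bool" where
  "first_category S \<longleftrightarrow> (\<exists>\<A>. countable \<A> \<and> (\<forall>A\<in>\<A>. nowhere_dense A) \<and> S = \<Union>\<A>)"

abbreviation second_category :: "'a::topological_space set \<Rightarrow> bool" where
  "second_category S \<equiv> \<not> first_category S"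

text \<open>The supremum is taken in the extended reals, so it is \<open>-\<infinity>\<close> if no \<open>F\<^sub>\<alpha>\<close> is of first category.\<close>

definition top_ess_inf :: "('a::topological_space \<Rightarrow> real) \<Rightarrow> ereal" where
  "top_ess_inf f = Sup {ereal \<alpha> |\<alpha>. first_category (strict_sublevel f (ereal \<alpha>))}"

lemma first_category_subset:
  assumes "first_category S" "T \<subseteq> S"
  shows "first_category T"
proof -
  obtain \<A> where A: "countable \<A>" "\<forall>A\<in>\<A>. nowhere_dense A" "S = \<Union>\<A>"
    using assms(1) unfolding first_category_def by (elim exE conjE)
  have "nowhere_dense (T \<inter> A)" if "A \<in> \<A>" for A
    using A(2)[rule_format, OF that] interior_mono[OF closure_mono[of "T \<inter> A" A]]
    by (simp add: nowhere_dense_def)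
  moreover have "T = \<Union>((\<inter>) T ` \<A>)"
    using A(3) assms(2) by auto
  ultimately show ?thesis
    unfolding first_category_def using A(1)
    by (intro exI[of _ "(\<inter>) T ` \<A>"] conjI countable_image) auto
qed

lemma top_ess_inf_eq_Inf:
  "top_ess_inf f = Inf {ereal \<alpha> |\<alpha>. second_category (strict_sublevel f (ereal \<alpha>))}"
  (is "_ = Inf ?B")
proof (rule antisym)
  show "top_ess_inf f \<le> Inf ?B"
    unfolding top_ess_inf_def
  proof (intro Sup_least Inf_greatest, clarify)
    fix \<alpha> \<beta> :: real
    assume a: "first_category (strict_sublevel f (ereal \<alpha>))"
      and b: "second_category (strict_sublevel f (ereal \<beta>))"
    show "ereal \<alpha> \<le> ereal \<beta>"
    proof (rule ccontr)
      assume "\<not> ereal \<alpha> \<le> ereal \<beta>"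
      then have "strict_sublevel f (ereal \<beta>) \<subseteq> strict_sublevel f (ereal \<alpha>)"
        by (auto simp: strict_sublevel_def)
      with a b show False using first_category_subset by blast
    qed
  qed
  show "Inf ?B \<le> top_ess_inf f"
  proof (rule ccontr)
    assume "\<not> Inf ?B \<le> top_ess_inf f"
    then obtain r where r: "top_ess_inf f < ereal r" "ereal r < Inf ?B"
      using ereal_dense2[of "top_ess_inf f" "Inf ?B"] by (auto simp: not_le)
    show False
    proof (cases "first_category (strict_sublevel f (ereal r))")
      case True
      then have "ereal r \<le> top_ess_inf f"
        unfolding top_ess_inf_def by (intro Sup_upper) blast
      with r(1) show False by simp
    next
      case False
      then have "Inf ?B \<le> ereal r" by (intro Inf_lower) blast
      with r(2) show False by simp
    qed
  qed
qed

end

theory Submission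
  imports Defs
begin

text \<open>
  Everything rests on one property of an ideally convex set \<open>C\<close> in a Banach space: every interior
  point of the closure of \<open>C\<close> already lies in \<open>C\<close>. As in the proof of the open mapping theorem, the
  successive approximation errors are rescaled, and the point is recovered as a series
  \<open>\<Sum> x\<^sub>n / 2\<^sup>n\<^sup>+\<^sup>1\<close> with bounded terms \<open>x\<^sub>n \<in> C\<close>.

  Two consequences follow. First, the frontier of \<open>C\<close> is nowhere dense, since an open set contained
  in the closure is contained in \<open>C\<close>. At a discontinuity, one of the one-sided semicontinuity
  conditions fails across some rational level \<open>q\<close>, so the point lies on the frontier of \<open>F'\<^sub>q\<close>; if
  \<open>f\<close> is ideally quasiconvex, then the discontinuities lie in a countable union of nowhere dense
  sets, and the Baire category theorem makes the continuity points dense.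

  Secondly, if \<open>C\<close> is of first category, then it is nowhere dense, since by the Baire category
  theorem it contains no nonempty open set. By the choice of \<open>m\<close>, the set \<open>F\<^sub>m\<close> is always of first
  category, being the union of the countably many first category sets \<open>F\<^sub>q\<close> with \<open>q < m\<close>
  rational. So \<open>F\<^sub>m\<close> is nowhere dense as soon as it is ideally convex.

  Strong ideal quasiconvexity is covered by the same argument: \<open>F'\<^sub>\<alpha>\<close> is the intersection of the sets
  \<open>F\<^sub>\<beta>\<close> with \<open>\<beta> > \<alpha>\<close>, and \<open>F\<^sub>m\<close> is a set \<open>F\<^sub>\<alpha>\<close> with real \<open>\<alpha>\<close>, or the empty set, or the whole
  space.
\<close>

section \<open>Ideally convex sets and their closures\<close>

lemma ideally_convexD:
  assumes "ideally_convex C" "\<And>n. x n \<in> C" "bounded (range x)"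
    and "\<And>n. l n \<in> {0..1}" "l sums 1"
  shows "(\<Sum>n. l n *\<^sub>R x n) \<in> C"
  using assms unfolding ideally_convex_def by blast

lemma ideally_convex_Inter:
  assumes "\<And>C. C \<in> \<C> \<Longrightarrow> ideally_convex C"
  shows "ideally_convex (\<Inter>\<C>)"
  unfolding ideally_convex_def by (auto intro!: ideally_convexD assms)

text \<open>A finite convex combination is a series whose remaining weights vanish.\<close>

lemma ideally_convex_imp_convex:
  assumes "ideally_convex C"
  shows "convex C"
proof (rule convexI)
  fix x y :: 'a and u v :: real
  assume "x \<in> C" "y \<in> C" "0 \<le> u" "0 \<le> v" "u + v = 1"
  define z where "z n = (if n = 0 then x else y)" for n :: nat
  define l where "l n = (if n = 0 then u else if n = 1 then v else 0)" for n :: nat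
  have "range z \<subseteq> {x, y}"
    by (auto simp: z_def)
  then have "bounded (range z)"
    by (rule bounded_subset[rotated]) simp
  moreover have "l sums 1"
    using sums_finite[of "{0, 1}" l] \<open>u + v = 1\<close> by (simp add: l_def)
  moreover have "z n \<in> C" "l n \<in> {0..1}" for n
    using \<open>x \<in> C\<close> \<open>y \<in> C\<close> \<open>0 \<le> u\<close> \<open>0 \<le> v\<close> \<open>u + v = 1\<close> by (auto simp: z_def l_def)
  ultimately have "(\<Sum>n. l n *\<^sub>R z n) \<in> C"
    using assms by (intro ideally_convexD)
  moreover have "(\<Sum>n. l n *\<^sub>R z n) = (\<Sum>n\<in>{0, 1}. l n *\<^sub>R z n)"
    by (rule suminf_finite) (auto simp: l_def)
  ultimately show "u *\<^sub>R x + v *\<^sub>R y \<in> C"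
    by (simp add: z_def l_def)
qed

text \<open>
  Let \<open>U\<close> be a ball contained in the closure of \<open>C\<close>. Each \<open>y \<in> U\<close> is the midpoint of a point of
  \<open>C \<inter> U\<close> and another point of \<open>U\<close>. Replacing the latter by such a midpoint again and
  again writes the centre as a series of points of \<open>C \<inter> U\<close> with weights \<open>1/2\<^sup>n\<^sup>+\<^sup>1\<close>.
\<close>

lemma ideally_convex_interior_closure_subset:
  assumes C: "ideally_convex C"
  shows "interior (closure C) \<subseteq> C"
proof
  fix p
  assume "p \<in> interior (closure C)"
  then obtain r where "0 < r" and r: "ball p r \<subseteq> closure C"
    by (auto simp: mem_interior)
  let ?U = "ball p r"
  have split: "\<exists>x. x \<in> C \<inter> ?U \<and> 2 *\<^sub>R y - x \<in> ?U" if "y \<in> ?U" for y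
  proof -
    let ?V = "?U \<inter> (\<lambda>x. 2 *\<^sub>R y - x) -` ?U"
    have "open ?V"
      by (intro open_Int open_ball open_vimage continuous_intros)
    moreover have "y \<in> ?V"
      using that by (simp add: scaleR_2)
    moreover have "y \<in> closure C"
      using that r by blast
    ultimately show ?thesis
      using open_Int_closure_eq_empty[of ?V C] by auto
  qed
  have "\<exists>y. \<forall>n. (y n \<in> ?U \<and> (n = 0 \<longrightarrow> y n = p)) \<and> 2 *\<^sub>R y n - y (Suc n) \<in> C \<inter> ?U"
  proof (rule dependent_nat_choice)
    show "\<exists>y. y \<in> ?U \<and> (0 = (0::nat) \<longrightarrow> y = p)"
      using \<open>0 < r\<close> by auto
  next
    fix y and n :: nat
    assume "y \<in> ?U \<and> (n = 0 \<longrightarrow> y = p)"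
    then obtain x where "x \<in> C \<inter> ?U" "2 *\<^sub>R y - x \<in> ?U"
      using split by blast
    then show "\<exists>z. (z \<in> ?U \<and> (Suc n = 0 \<longrightarrow> z = p)) \<and> 2 *\<^sub>R y - z \<in> C \<inter> ?U"
      by (intro exI[of _ "2 *\<^sub>R y - x"]) auto
  qed
  then obtain y where y: "\<And>n. y n \<in> ?U" "y 0 = p"
    and x: "\<And>n. 2 *\<^sub>R y n - y (Suc n) \<in> C \<inter> ?U"
    by blast
  \<comment> \<open>Since \<open>y n = x n / 2 + y (n + 1) / 2\<close>, the series of \<open>x n / 2\<^sup>n\<^sup>+\<^sup>1\<close> has the remainders \<open>y n / 2\<^sup>n\<close>.\<close>
  define x where "x n = 2 *\<^sub>R y n - y (Suc n)" for n
  define l where "l n = (1/2::real) ^ Suc n" for n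
  have partial: "(\<Sum>n<N. l n *\<^sub>R x n) = p - (1/2) ^ N *\<^sub>R y N" for N
    by (induction N) (auto simp: y(2) x_def l_def algebra_simps)
  have "bounded (range y)"
    using y(1) by (intro bounded_subset[OF bounded_ball[of p r]]) auto
  then have "Bfun y sequentially"
    by (simp add: Bseq_eq_bounded)
  moreover have "Zfun (\<lambda>N. (1/2::real) ^ N) sequentially"
    unfolding tendsto_Zfun_iff[of _ 0, simplified, symmetric] by (rule LIMSEQ_realpow_zero) auto
  ultimately have "Zfun (\<lambda>N. (1/2) ^ N *\<^sub>R y N) sequentially"
    by (intro bounded_bilinear.Zfun_prod_Bfun[OF bounded_bilinear_scaleR])
  then have "(\<lambda>N. (1/2) ^ N *\<^sub>R y N) \<longlonglongrightarrow> 0"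
    by (simp add: tendsto_Zfun_iff)
  from tendsto_diff[OF tendsto_const[of p] this] have "(\<lambda>n. l n *\<^sub>R x n) sums p"
    by (simp add: sums_def partial)
  moreover have "(\<Sum>n. l n *\<^sub>R x n) \<in> C"
  proof (rule ideally_convexD[OF C])
    show "x n \<in> C" for n
      using x by (simp add: x_def)
    show "bounded (range x)"
      using x by (intro bounded_subset[OF bounded_ball[of p r]]) (auto simp: x_def)
    show "l n \<in> {0..1}" for n
      by (auto simp: l_def simp del: power_Suc intro: power_le_one)
    show "l sums 1"
      unfolding l_def by (rule power_half_series)
  qed
  ultimately show "p \<in> C"
    by (simp add: sums_unique[symmetric])
qed

lemma nowhere_dense_frontier_ideally_convex:
  assumes "ideally_convex C"
  shows "nowhere_dense (frontier C)"
proof -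
  have "interior (frontier C) \<subseteq> interior (closure C)"
    by (intro interior_mono) (auto simp: frontier_def)
  also have "\<dots> \<subseteq> interior C"
    using ideally_convex_interior_closure_subset[OF assms] by (intro interior_maximal) auto
  finally have "interior (frontier C) \<subseteq> interior C \<inter> frontier C"
    using interior_subset by blast
  then have "interior (frontier C) = {}"
    by (auto simp: frontier_def)
  then show ?thesis
    by (simp add: nowhere_dense_def closure_closed[OF frontier_closed])
qed

section \<open>Sets of first category\<close>

text \<open>The Baire category theorem, applied to the closures of the nowhere dense pieces.\<close>

lemma interior_first_category_eq_empty:
  fixes S :: "'a::complete_space set"
  assumes "first_category S"
  shows "interior S = {}"
proof -
  obtain \<A> where \<A>: "countable \<A>" "\<And>A. A \<in> \<A> \<Longrightarrow> nowhere_dense A" "S = \<Union>\<A>"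
    using assms unfolding first_category_def by blast
  have "Met_TC.mcomplete TYPE('a)"
    by (simp add: complete_UNIV)
  then have "interior (\<Union>(closure ` \<A>)) = {}"
    using Met_TC.metric_Baire_category_alt[where ?'a = 'a and \<G> = "closure ` \<A>"] \<A>
    by (auto simp: nowhere_dense_def)
  moreover have "S \<subseteq> \<Union>(closure ` \<A>)"
    using \<A>(3) closure_subset by blast
  ultimately show ?thesis
    using interior_mono by blast
qed

lemma first_category_UN:
  assumes "countable I" "\<And>i. i \<in> I \<Longrightarrow> first_category (S i)"
  shows "first_category (\<Union>i\<in>I. S i)"
proof -
  obtain \<A> where \<A>: "\<And>i. i \<in> I \<Longrightarrow>
      countable (\<A> i) \<and> (\<forall>A\<in>\<A> i. nowhere_dense A) \<and> S i = \<Union>(\<A> i)"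
    using assms(2) unfolding first_category_def by metis
  then have "countable (\<Union>i\<in>I. \<A> i)" "(\<Union>i\<in>I. S i) = \<Union>(\<Union>i\<in>I. \<A> i)"
    using assms(1) by auto
  moreover have "nowhere_dense A" if "A \<in> (\<Union>i\<in>I. \<A> i)" for A
    using that \<A> by auto
  ultimately show ?thesis
    unfolding first_category_def by (intro exI[of _ "\<Union>i\<in>I. \<A> i"]) simp
qed

lemma first_category_nowhere_dense: "nowhere_dense S \<Longrightarrow> first_category S"
  unfolding first_category_def by (intro exI[of _ "{S}"]) simp

lemma ideally_convex_first_category_imp_nowhere_dense:
  assumes "ideally_convex C" "first_category C"
  shows "nowhere_dense C"
  using interior_maximal[OF ideally_convex_interior_closure_subset[OF assms(1)] open_interior]
    interior_first_category_eq_empty[OF assms(2)]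
  by (simp add: nowhere_dense_def)

section \<open>Ideally quasiconvex functions\<close>

text \<open>
  The neighbourhood \<open>interior F'\<^sub>q - closure F'\<^sub>p\<close> traps the values of \<open>f\<close> between rationals
  \<open>p < f x < q\<close> that may be chosen arbitrarily close to \<open>f x\<close>.
\<close>

lemma isCont_if_notin_frontier_sublevels:
  fixes f :: "'a::t2_space \<Rightarrow> real"
  assumes x: "\<And>q. q \<in> \<rat> \<Longrightarrow> x \<notin> frontier (sublevel f (ereal q))"
  shows "isCont f x"
  unfolding isCont_def
proof (rule order_tendstoI)
  fix a
  assume "a < f x"
  then obtain p where p: "p \<in> \<rat>" "a < p" "p < f x"
    using Rats_dense_in_real by blast
  then have "x \<notin> sublevel f (ereal p)"
    by (simp add: sublevel_def)
  with x[OF p(1)] have "x \<in> - closure (sublevel f (ereal p))"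
    using interior_subset by (auto simp: frontier_def)
  then have "\<forall>\<^sub>F z in at x. z \<in> - closure (sublevel f (ereal p))"
    by (intro eventually_at_in_open') auto
  then show "\<forall>\<^sub>F z in at x. a < f z"
    by eventually_elim
      (use p(2) closure_subset[of "sublevel f (ereal p)"] in \<open>force simp: sublevel_def\<close>)
next
  fix a
  assume "f x < a"
  then obtain q where q: "q \<in> \<rat>" "f x < q" "q < a"
    using Rats_dense_in_real by blast
  then have "x \<in> closure (sublevel f (ereal q))"
    using closure_subset by (fastforce simp: sublevel_def)
  with x[OF q(1)] have "x \<in> interior (sublevel f (ereal q))"
    by (simp add: frontier_def)
  then have "\<forall>\<^sub>F z in at x. z \<in> interior (sublevel f (ereal q))"
    by (intro eventually_at_in_open') auto
  then show "\<forall>\<^sub>F z in at x. f z < a"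
    by eventually_elim
      (use q(3) interior_subset[of "sublevel f (ereal q)"] in \<open>force simp: sublevel_def\<close>)
qed

lemma ideally_quasiconvex_imp_densely_continuous:
  assumes "ideally_quasiconvex f"
  shows "densely_continuous f"
proof -
  let ?B = "\<Union>q\<in>\<rat>. frontier (sublevel f (ereal q))"
  have "first_category ?B"
    using assms unfolding ideally_quasiconvex_def
    by (intro first_category_UN first_category_nowhere_dense
        nowhere_dense_frontier_ideally_convex countable_rat) auto
  then have "closure (- ?B) = UNIV"
    using interior_first_category_eq_empty by (metis closure_complement Compl_empty_eq)
  then show ?thesis
    unfolding densely_continuous_def
    by (intro exI[of _ "- ?B"]) (auto intro: isCont_if_notin_frontier_sublevels)
qed

lemma ideally_quasiconvex_imp_quasiconvex:
  assumes "ideally_quasiconvex f"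
  shows "quasiconvex f"
  unfolding quasiconvex_def
proof (intro allI ballI)
  fix x y and l :: real
  assume "l \<in> {0..1}"
  let ?F = "sublevel f (ereal (max (f x) (f y)))"
  have "convex ?F"
    using assms unfolding ideally_quasiconvex_def by (intro ideally_convex_imp_convex) blast
  moreover have "x \<in> ?F" "y \<in> ?F"
    by (auto simp: sublevel_def)
  ultimately have "l *\<^sub>R x + (1 - l) *\<^sub>R y \<in> ?F"
    using \<open>l \<in> {0..1}\<close> by (intro convexD) auto
  then show "f (l *\<^sub>R x + (1 - l) *\<^sub>R y) \<le> max (f x) (f y)"
    unfolding sublevel_def mem_Collect_eq ereal_less_eq .
qed

lemma strongly_ideally_quasiconvex_imp_ideally_quasiconvex:
  assumes "strongly_ideally_quasiconvex f"
  shows "ideally_quasiconvex f"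
  unfolding ideally_quasiconvex_def
proof
  fix \<alpha> :: real
  have "sublevel f (ereal \<alpha>) = \<Inter>((\<lambda>\<beta>. strict_sublevel f (ereal \<beta>)) ` {\<alpha><..})"
    by (auto simp: sublevel_def strict_sublevel_def intro: dense_ge)
  then show "ideally_convex (sublevel f (ereal \<alpha>))"
    using assms by (auto simp: strongly_ideally_quasiconvex_def intro!: ideally_convex_Inter)
qed

lemma strongly_ideally_quasiconvex_imp_ideally_convex:
  assumes "strongly_ideally_quasiconvex f"
  shows "ideally_convex (strict_sublevel f \<alpha>)"
proof (cases \<alpha>)
  case (real r)
  with assms show ?thesis
    by (simp add: strongly_ideally_quasiconvex_def)
qed (simp_all add: strict_sublevel_def ideally_convex_def)

lemma first_category_strict_sublevel_top_ess_inf: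
  "first_category (strict_sublevel f (top_ess_inf f))"
proof -
  let ?Q = "{q \<in> \<rat>. ereal q < top_ess_inf f}"
  have "first_category (strict_sublevel f (ereal q))" if q: "ereal q < top_ess_inf f" for q
  proof -
    obtain \<alpha> where "first_category (strict_sublevel f (ereal \<alpha>))" "q < \<alpha>"
      using q unfolding top_ess_inf_def less_Sup_iff by auto
    then show ?thesis
      by (elim first_category_subset) (auto simp: strict_sublevel_def)
  qed
  then have "first_category (\<Union>q\<in>?Q. strict_sublevel f (ereal q))"
    by (intro first_category_UN countable_subset[OF _ countable_rat]) auto
  moreover have "strict_sublevel f (top_ess_inf f) \<subseteq> (\<Union>q\<in>?Q. strict_sublevel f (ereal q))"
  proof
    fix x
    assume "x \<in> strict_sublevel f (top_ess_inf f)"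
    then have "ereal (f x) < top_ess_inf f"
      by (simp add: strict_sublevel_def)
    then obtain s where s: "ereal (f x) < ereal s" "ereal s < top_ess_inf f"
      using ereal_dense2 by blast
    then obtain q where "q \<in> \<rat>" "f x < q" "q < s"
      using Rats_dense_in_real by auto
    moreover from this s have "ereal q < top_ess_inf f"
      using less_trans[of "ereal q" "ereal s"] by simp
    ultimately show "x \<in> (\<Union>q\<in>?Q. strict_sublevel f (ereal q))"
      by (auto simp: strict_sublevel_def)
  qed
  ultimately show ?thesis
    by (rule first_category_subset)
qed

theorem theorem3p4:
  fixes f :: "'a::banach \<Rightarrow> real"
  shows "(ideally_quasiconvex f \<longrightarrow> quasiconvex f \<and> densely_continuous f) \<and>
    (strongly_ideally_quasiconvex f \<longrightarrow>
      quasiconvex f \<and> densely_continuous f \<and>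
      nowhere_dense (strict_sublevel f (top_ess_inf f))) \<and>
    (ideally_quasiconvex f \<and> ideally_convex (strict_sublevel f (top_ess_inf f)) \<longrightarrow>
      quasiconvex f \<and> densely_continuous f \<and>
      nowhere_dense (strict_sublevel f (top_ess_inf f)))"
  using ideally_quasiconvex_imp_quasiconvex[of f]
    ideally_quasiconvex_imp_densely_continuous[of f]
    strongly_ideally_quasiconvex_imp_ideally_quasiconvex[of f]
    strongly_ideally_quasiconvex_imp_ideally_convex[of f "top_ess_inf f"]
    ideally_convex_first_category_imp_nowhere_dense[OF _
      first_category_strict_sublevel_top_ess_inf[of f]]
  by blast

end
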